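(* Let $\mathcal{D}\subseteq\mathbb{R}^d$, and let $f:\mathcal{D}\rightarrow\mathbb{R}$ be a continuous function equipped with an extended convex lifting (ECL) $(\mathcal{L}_{\mathrm{lft}},\mathcal{F}_{\mathrm{cvx}},\mathcal{G}_{\mathrm{aux}},\Phi)$. Then $$\inf_{x\in\mathcal{D}} f(x) = \inf_{(\gamma,\zeta_1)\in\mathcal{F}_{\mathrm{cvx}}} \gamma .$$
   Context: For $f:\mathcal{D}\to\mathbb{R}$ with $\mathcal{D}\subseteq\mathbb{R}^d$, put $\operatorname{epi}_>(f)=\{(x,\gamma)\in\mathcal{D}\times\mathbb{R}\mid \gamma>f(x)\}$ and $\operatorname{epi}_\geq(f)=\{(x,\gamma)\in\mathcal{D}\times\mathbb{R}\mid \gamma\geq f(x)\}$; $\operatorname{cl}$ denotes closure in $\mathbb{R}^{d}\times\mathbb{R}$. Definition (ECL). Let $f:\mathcal{D}\to\mathbb{R}$ be continuous, $\mathcal{D}\subseteq\mathbb{R}^d$. The tuple $(\mathcal{L}_{\mathrm{lft}},\mathcal{F}_{\mathrm{cvx}},\mathcal{G}_{\mathrm{aux}},\Phi)$ is an extended convex lifting (ECL) of $f$ if: (1) $\mathcal{L}_{\mathrm{lft}}\subseteq\mathbb{R}^d\times\mathbb{R}\times\mathbb{R}^{d_\xi}$ is a set whose canonical projection $\pi_{x,\gamma}(\mathcal{L}_{\mathrm{lft}})=\{(x,\gamma): \exists\,\xi\in\mathbb{R}^{d_\xi}\text{ s.t. }(x,\gamma,\xi)\in\mathcal{L}_{\mathrm{lft}}\}$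 satisfies $\operatorname{epi}_>(f)\subseteq\pi_{x,\gamma}(\mathcal{L}_{\mathrm{lft}})\subseteq\operatorname{cl}\operatorname{epi}_\geq(f)$; (2) $\mathcal{F}_{\mathrm{cvx}}\subseteq\mathbb{R}\times\mathbb{R}^{d_1}$ is a convex set, $\mathcal{G}_{\mathrm{aux}}\subseteq\mathbb{R}^{d_2}$ is a set (the auxiliary set), and $\Phi$ is a $C^2$ diffeomorphism from $\mathcal{L}_{\mathrm{lft}}$ to $\mathcal{F}_{\mathrm{cvx}}\times\mathcal{G}_{\mathrm{aux}}$, meaning that $\Phi$ is a bijection from $\mathcal{L}_{\mathrm{lft}}$ onto $\mathcal{F}_{\mathrm{cvx}}\times\mathcal{G}_{\mathrm{aux}}$ that extends to a $C^2$ function $\tilde\Phi$ on some open set $U\supseteq\mathcal{L}_{\mathrm{lft}}$ of $\mathbb{R}^d\times\mathbb{R}\times\mathbb{R}^{d_\xi}$ such that $\tilde\Phi$ is a bijection from $U$ to $\tilde\Phi(U)$ with $C^2$ inverse. ($d_2=0$ is allowed, with $\mathcal{G}_{\mathrm{aux}}=\mathbb{R}^0=\{0\}$ and $\mathcal{F}_{\mathrm{cvx}}\times\{0\}$ identified with $\mathcal{F}_{\mathrm{cvx}}$; $\mathcal{G}_{\mathrm{aux}}$ may be nonconvex or disconnected.) (3) For every $(x,\gamma,\xi)\in\mathcal{L}_{\mathrm{lft}}$, $\Phi(x,\gamma,\xi)=(\gamma,\zeta_1,\zeta_2)$ with $(\gamma,\zeta_1)\in\mathcal{F}_{\mathrm{cvx}}$,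 for some $\zeta_1\in\mathbb{R}^{d_1}$ and $\zeta_2\in\mathcal{G}_{\mathrm{aux}}$ (i.e. $\Phi$ outputs $\gamma$ itself as its first component).
   Formalization: It is additionally assumed that the domain D and the auxiliary set G_aux are not both empty; if both are empty, the lifted set is empty and any nonempty convex F_cvx satisfies the ECL definition vacuously, so the stated equality fails. *)

theory Defs
  imports "HOL-Analysis.Analysis"
begin

text \<open>
  The spaces \<open>\<real>\<^sup>k\<close> with \<open>k \<ge> 0\<close>. The library class \<^class>\<open>euclidean_space\<close> excludes dimension
  zero (its \<open>Basis\<close> is nonempty), while lifting and auxiliary variables may be absent.
  Every member of the class below is isometric to \<open>\<real>\<^sup>k\<close> for some \<open>k\<close>, and every \<open>k \<ge> 0\<close> occurs:
  see the instances that follow.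
\<close>

class finite_dim_inner = real_inner +
  assumes finite_spanning_set: "\<exists>B. finite B \<and> (\<forall>x. \<exists>c. x = (\<Sum>b\<in>B. scaleR (c b) b))"

subclass (in euclidean_space) finite_dim_inner
proof
  have "x = (\<Sum>b\<in>Basis. scaleR (inner x b) b)" for x
  proof (rule euclidean_eqI)
    fix u :: 'a assume "u \<in> Basis"
    then show "inner x u = inner (\<Sum>b\<in>Basis. scaleR (inner x b) b) u"
      by (simp add: inner_sum_left inner_Basis if_distrib cong: if_cong)
  qed
  then show "\<exists>B. finite B \<and> (\<forall>x. \<exists>c. x = (\<Sum>b\<in>B. scaleR (c b) b))"
    by (intro exI[of _ Basis]) auto
qed

datatype zero_space = Origin

lemma zero_space_eq: "x = y" for x y :: zero_space
  by (cases x; cases y) simp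

instantiation zero_space :: real_inner
begin

definition zero_zero_space :: zero_space where "0 = Origin"
definition plus_zero_space :: "zero_space \<Rightarrow> zero_space \<Rightarrow> zero_space" where "x + y = Origin"
definition minus_zero_space :: "zero_space \<Rightarrow> zero_space \<Rightarrow> zero_space" where "x - y = Origin"
definition uminus_zero_space :: "zero_space \<Rightarrow> zero_space" where "- x = Origin"
definition scaleR_zero_space :: "real \<Rightarrow> zero_space \<Rightarrow> zero_space" where "scaleR r x = Origin"
definition inner_zero_space :: "zero_space \<Rightarrow> zero_space \<Rightarrow> real" where "inner_zero_space x y = 0"
definition norm_zero_space :: "zero_space \<Rightarrow> real" where "norm_zero_space x = 0"
definition sgn_zero_space :: "zero_space \<Rightarrow> zero_space" where "sgn x = Origin"
definition dist_zero_space :: "zero_space \<Rightarrow> zero_space \<Rightarrow> real" where "dist_zero_space x y = 0"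
definition uniformity_zero_space :: "(zero_space \<times> zero_space) filter" where
  "uniformity_zero_space = (INF e\<in>{0<..}. principal {(x, y). dist x y < e})"
definition open_zero_space :: "zero_space set \<Rightarrow> bool" where
  "open_zero_space U \<longleftrightarrow> (\<forall>x\<in>U. eventually (\<lambda>(x', y). x' = x \<longrightarrow> y \<in> U) uniformity)"

instance
  by standard (auto simp: plus_zero_space_def scaleR_zero_space_def inner_zero_space_def norm_zero_space_def
      dist_zero_space_def uniformity_zero_space_def open_zero_space_def
      intro: zero_space_eq)

end

instance zero_space :: finite_dim_inner
proof
  show "\<exists>B. finite B \<and> (\<forall>x. \<exists>c. x = (\<Sum>b\<in>B. c b *\<^sub>R b :: zero_space))"
    by (intro exI[of _ "{}"]) (auto intro: zero_space_eq)
qed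


text \<open>The non-strict epigraph is \<^const>\<open>epigraph\<close>.\<close>

definition strict_epigraph :: "'a set \<Rightarrow> ('a \<Rightarrow> real) \<Rightarrow> ('a \<times> real) set" where
  "strict_epigraph D f = {(x, \<gamma>). x \<in> D \<and> \<gamma> > f x}"

definition C2_on_open :: "'a::real_normed_vector set \<Rightarrow> ('a \<Rightarrow> 'b::real_normed_vector) \<Rightarrow> bool" where
  "C2_on_open U f \<longleftrightarrow> open U \<and>
    (\<exists>(f' :: 'a \<Rightarrow> 'a \<Rightarrow>\<^sub>L 'b) (f'' :: 'a \<Rightarrow> 'a \<Rightarrow>\<^sub>L 'a \<Rightarrow>\<^sub>L 'b).
      (\<forall>x\<in>U. (f has_derivative blinfun_apply (f' x)) (at x)) \<and>
      (\<forall>x\<in>U. (f' has_derivative blinfun_apply (f'' x)) (at x)) \<and>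
      continuous_on U f'')"

text \<open>
  On a set that need not be open, \<open>C\<^sup>2\<close> means being the restriction of a \<open>C\<^sup>2\<close> function on an
  open superset; on open sets this is the ordinary notion (next lemma).
\<close>

definition C2_on :: "'a::real_normed_vector set \<Rightarrow> ('a \<Rightarrow> 'b::real_normed_vector) \<Rightarrow> bool" where
  "C2_on S f \<longleftrightarrow> (\<exists>U g. S \<subseteq> U \<and> C2_on_open U g \<and> (\<forall>x\<in>S. g x = f x))"

lemma C2_on_iff_C2_on_open:
  assumes "open S"
  shows "C2_on S f \<longleftrightarrow> C2_on_open S f"
proof
  assume "C2_on S f"
  then obtain U g where Ug: "S \<subseteq> U" "C2_on_open U g" "\<forall>x\<in>S. g x = f x"
    unfolding C2_on_def by blast
  from Ug(2) obtain g' g''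
    where g': "\<forall>x\<in>U. (g has_derivative blinfun_apply (g' x)) (at x)"
      and g'': "\<forall>x\<in>U. (g' has_derivative blinfun_apply (g'' x)) (at x)" "continuous_on U g''"
    unfolding C2_on_open_def by blast
  have "(f has_derivative blinfun_apply (g' x)) (at x)" if "x \<in> S" for x
    by (rule has_derivative_transform_within_open[of g _ x UNIV S]) (use that g' Ug assms in auto)
  then show "C2_on_open S f"
    unfolding C2_on_open_def using assms g'' Ug(1) continuous_on_subset by blast
next
  assume "C2_on_open S f"
  then show "C2_on S f" unfolding C2_on_def by blast
qed

definition C2_diffeomorphism ::
    "('a::real_normed_vector \<Rightarrow> 'b::real_normed_vector) \<Rightarrow> 'a set \<Rightarrow> 'b set \<Rightarrow> bool" where
  "C2_diffeomorphism \<Phi> A B \<longleftrightarrow> bij_betw \<Phi> A B \<and>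
    (\<exists>U \<Psi>. open U \<and> A \<subseteq> U \<and> (\<forall>x\<in>A. \<Psi> x = \<Phi> x) \<and> C2_on U \<Psi> \<and>
      bij_betw \<Psi> U (\<Psi> ` U) \<and> C2_on (\<Psi> ` U) (the_inv_into U \<Psi>))"

text \<open>
  A point \<open>(\<gamma>, \<zeta>\<^sub>1, \<zeta>\<^sub>2)\<close> of the codomain of \<open>\<Phi>\<close> is encoded as \<open>((\<gamma>, \<zeta>\<^sub>1), \<zeta>\<^sub>2)\<close>, so that the
  target is literally the product \<open>F \<times> G\<close>. Continuity of \<open>f\<close> on \<open>D\<close> is a hypothesis on the
  function, not part of this predicate.
\<close>

definition extended_convex_lifting ::
    "'x::finite_dim_inner set \<Rightarrow> ('x \<Rightarrow> real) \<Rightarrow>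
     ('x \<times> real \<times> 'xi::finite_dim_inner) set \<Rightarrow> (real \<times> 'z1::finite_dim_inner) set \<Rightarrow>
     'z2::finite_dim_inner set \<Rightarrow> ('x \<times> real \<times> 'xi \<Rightarrow> (real \<times> 'z1) \<times> 'z2) \<Rightarrow> bool" where
  "extended_convex_lifting D f L F G \<Phi> \<longleftrightarrow>
    strict_epigraph D f \<subseteq> {(x, \<gamma>). \<exists>\<xi>. (x, \<gamma>, \<xi>) \<in> L} \<and>
    {(x, \<gamma>). \<exists>\<xi>. (x, \<gamma>, \<xi>) \<in> L} \<subseteq> closure (epigraph D f) \<and>
    convex F \<and>
    C2_diffeomorphism \<Phi> L (F \<times> G) \<and>
    (\<forall>x \<gamma> \<xi>. (x, \<gamma>, \<xi>) \<in> L \<longrightarrow>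
      (\<exists>\<zeta>\<^sub>1 \<zeta>\<^sub>2. \<Phi> (x, \<gamma>, \<xi>) = ((\<gamma>, \<zeta>\<^sub>1), \<zeta>\<^sub>2) \<and> (\<gamma>, \<zeta>\<^sub>1) \<in> F \<and> \<zeta>\<^sub>2 \<in> G))"

end

theory Submission
  imports Defs
begin

text \<open>
  Since \<open>\<Phi>\<close> maps onto \<open>F \<times> G\<close> and preserves \<open>\<gamma>\<close>, for nonempty \<open>G\<close> the values \<open>\<gamma>\<close> occurring in
  \<open>F\<close> are exactly those occurring in the projection of \<open>L\<close> to the \<open>(x, \<gamma>)\<close>-space. That projection
  lies between the strict epigraph and the closure of the epigraph, and the infimum of \<open>\<gamma>\<close> over
  either of these is \<open>inf f\<close>: passing to the closure does not lower it, because a half-space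
  \<open>{(x, \<gamma>). m \<le> \<gamma>}\<close> is closed (\<open>INF_le_height_closure_epigraph\<close>). An empty \<open>G\<close> would
  make \<open>L\<close> empty, hence the strict epigraph and \<open>D\<close> too, which the hypothesis
  \<open>D \<noteq> {} \<or> G \<noteq> {}\<close> excludes.
\<close>

lemma INF_le_height_closure_epigraph:
  fixes D :: "'a::real_normed_vector set" and f :: "'a \<Rightarrow> real"
  assumes "(x, \<gamma>) \<in> closure (epigraph D f)"
  shows "(INF x\<in>D. ereal (f x)) \<le> ereal \<gamma>"
proof -
  let ?H = "{p :: 'a \<times> real. (INF x\<in>D. ereal (f x)) \<le> ereal (snd p)}"
  have "closed ?H"
    by (intro closed_Collect_le continuous_intros)
  moreover have "epigraph D f \<subseteq> ?H"
    by (auto simp: epigraph_def intro: INF_lower2)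
  ultimately have "closure (epigraph D f) \<subseteq> ?H"
    by (rule closure_minimal[rotated])
  with assms show ?thesis by auto
qed

lemma ECL_surj:
  assumes "extended_convex_lifting D f L F G \<Phi>"
  shows "\<Phi> ` L = F \<times> G"
proof -
  have "bij_betw \<Phi> L (F \<times> G)"
    using assms by (simp add: extended_convex_lifting_def C2_diffeomorphism_def)
  then show ?thesis by (rule bij_betw_imp_surj_on)
qed

text \<open>
  A nonempty \<open>G\<close> is needed here: otherwise \<open>L\<close> is empty, while \<open>F\<close> may be any convex set.
\<close>

lemma ECL_heights_eq:
  assumes "extended_convex_lifting D f L F G \<Phi>" and "G \<noteq> {}"
  shows "fst ` F = {\<gamma>. \<exists>x \<xi>. (x, \<gamma>, \<xi>) \<in> L}"
proof -
  note onto = ECL_surj[OF assms(1)]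
  from assms(1) have height: "\<And>x \<gamma> \<xi>. (x, \<gamma>, \<xi>) \<in> L \<Longrightarrow>
      \<exists>\<zeta>\<^sub>1 \<zeta>\<^sub>2. \<Phi> (x, \<gamma>, \<xi>) = ((\<gamma>, \<zeta>\<^sub>1), \<zeta>\<^sub>2) \<and> (\<gamma>, \<zeta>\<^sub>1) \<in> F \<and> \<zeta>\<^sub>2 \<in> G"
    by (simp add: extended_convex_lifting_def)
  show ?thesis
  proof (intro equalityI subsetI)
    fix \<gamma> assume "\<gamma> \<in> fst ` F"
    then obtain \<zeta>\<^sub>1 where "(\<gamma>, \<zeta>\<^sub>1) \<in> F" by auto
    moreover obtain \<zeta>\<^sub>2 where "\<zeta>\<^sub>2 \<in> G" using assms(2) by blast
    ultimately have "((\<gamma>, \<zeta>\<^sub>1), \<zeta>\<^sub>2) \<in> \<Phi> ` L" by (simp add: onto)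
    then obtain x \<gamma>' \<xi> where p: "(x, \<gamma>', \<xi>) \<in> L" "\<Phi> (x, \<gamma>', \<xi>) = ((\<gamma>, \<zeta>\<^sub>1), \<zeta>\<^sub>2)"
      by (metis imageE prod_cases3)
    from height[OF p(1)] p(2) have "\<gamma>' = \<gamma>" by simp
    with p(1) show "\<gamma> \<in> {\<gamma>. \<exists>x \<xi>. (x, \<gamma>, \<xi>) \<in> L}" by blast
  next
    fix \<gamma> assume "\<gamma> \<in> {\<gamma>. \<exists>x \<xi>. (x, \<gamma>, \<xi>) \<in> L}"
    then obtain x \<xi> where "(x, \<gamma>, \<xi>) \<in> L" by blast
    from height[OF this] obtain \<zeta>\<^sub>1 where "(\<gamma>, \<zeta>\<^sub>1) \<in> F" by blast
    then show "\<gamma> \<in> fst ` F" by (rule image_eqI[rotated]) simp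
  qed
qed

theorem theorem3p1:
  fixes D :: "'x::finite_dim_inner set"
    and f :: "'x \<Rightarrow> real"
    and L :: "('x \<times> real \<times> 'xi::finite_dim_inner) set"
    and F :: "(real \<times> 'z1::finite_dim_inner) set"
    and G :: "'z2::finite_dim_inner set"
    and \<Phi> :: "'x \<times> real \<times> 'xi \<Rightarrow> (real \<times> 'z1) \<times> 'z2"
  assumes "continuous_on D f"
    and "extended_convex_lifting D f L F G \<Phi>"
    and "D \<noteq> {} \<or> G \<noteq> {}"
  shows "(INF x\<in>D. ereal (f x)) = (INF (\<gamma>, \<zeta>\<^sub>1)\<in>F. ereal \<gamma>)"
proof -
  from assms(2) have strict: "\<And>x \<gamma>. x \<in> D \<Longrightarrow> f x < \<gamma> \<Longrightarrow> \<exists>\<xi>. (x, \<gamma>, \<xi>) \<in> L"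
    and clos: "\<And>x \<gamma> \<xi>. (x, \<gamma>, \<xi>) \<in> L \<Longrightarrow> (x, \<gamma>) \<in> closure (epigraph D f)"
    by (auto simp: extended_convex_lifting_def strict_epigraph_def)
  have "G \<noteq> {}"
  proof
    assume "G = {}"
    with ECL_surj[OF assms(2)] have "L = {}" by simp
    moreover from \<open>G = {}\<close> assms(3) obtain x where "x \<in> D" by blast
    ultimately show False using strict[of x "f x + 1"] by simp
  qed
  then have heights: "fst ` F = {\<gamma>. \<exists>x \<xi>. (x, \<gamma>, \<xi>) \<in> L}"
    by (rule ECL_heights_eq[OF assms(2)])
  have "(INF x\<in>D. ereal (f x)) = (INF \<gamma>\<in>fst ` F. ereal \<gamma>)"
  proof (rule antisym)
    show "(INF x\<in>D. ereal (f x)) \<le> (INF \<gamma>\<in>fst ` F. ereal \<gamma>)"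
      unfolding heights
      by (rule INF_greatest) (auto intro: INF_le_height_closure_epigraph clos)
  next
    show "(INF \<gamma>\<in>fst ` F. ereal \<gamma>) \<le> (INF x\<in>D. ereal (f x))"
    proof (rule INF_greatest)
      fix x assume x: "x \<in> D"
      have "(INF \<gamma>\<in>fst ` F. ereal \<gamma>) \<le> ereal (f x) + ereal e" if "0 < e" for e
      proof -
        have "f x + e \<in> fst ` F"
          unfolding heights using strict[of x "f x + e"] x that by auto
        then have "(INF \<gamma>\<in>fst ` F. ereal \<gamma>) \<le> ereal (f x + e)" by (rule INF_lower)
        then show ?thesis by simp
      qed
      then show "(INF \<gamma>\<in>fst ` F. ereal \<gamma>) \<le> ereal (f x)"
        by (simp add: ereal_le_epsilon2)
    qed
  qed
  then show ?thesis by (simp add: image_comp comp_def case_prod_unfold)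
qed

end
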